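(* Let $p$ and $n$ be positive integers and let $$S_{p,n} = \langle p^{2n+1},\ p^{2n+1}+p^n,\ p^{2n+1}+p^{n+1},\ p^{2n+1}+p^{n+1}+1\rangle .$$ Then $\mathrm E(S_{p,n},2)=p^{2n+1}-p^{2n}+p^n$.
   Context: $\mathbb N$ denotes the non-negative integers, and $\langle n_1,\dots,n_m\rangle:=n_1\mathbb N+\cdots+n_m\mathbb N$, which is a numerical semigroup when the $n_i$ are positive integers with $\gcd(n_1,\dots,n_m)=1$. $S_{p,n}$ is called the generalized Suzuki numerical semigroup. For a numerical semigroup $\Gamma$ and $x\in\mathbb Z$, the Apéry set is $\operatorname{Ap}(\Gamma,x)=\{a\in\Gamma\mid a-x\notin\Gamma\}$. Second Feng-Rao number: for $b\in\Gamma$ let $\mathrm D(b)=\{c\in\Gamma\mid b-c\in\Gamma\}$, and let $\delta^2_{FR}(a)=\min\{\#(\mathrm D(b_1)\cup \mathrm D(b_2))\mid b_1,b_2\in\Gamma,\ a\le b_1<b_2\}$. With $c$ the conductor of $\Gamma$ (least integer $c\ge0$ such that all integers $\ge c$ lie in $\Gamma$) and $g=\#(\mathbb N\setminus\Gamma)$ the genus, $\mathrm E(\Gamma,2)$ is the constant such that $\delta^2_{FR}(a)=a+1-2g+\mathrm E(\Gamma,2)$ for all non-negative integers $a\ge 2c-1$. It is known (and may be taken as the definition) that $\mathrm E(\Gamma,2)=\min\{\#\operatorname{Ap}(\Gamma,x)\mid x\in\mathbb N\setminus\{0\}\}$. *)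

theory Defs
  imports Main
begin

text \<open>
  A numerical semigroup is represented as a set of natural numbers. Truncated subtraction
  is avoided by explicit guards or by passing to the integers.
\<close>

definition generated :: "nat list \<Rightarrow> nat set" where
  "generated ns = {\<Sum>i<length ns. k i * ns ! i | k :: nat \<Rightarrow> nat. True}"

definition suzuki :: "nat \<Rightarrow> nat \<Rightarrow> nat set" where
  "suzuki p n = generated
     [p ^ (2 * n + 1),
      p ^ (2 * n + 1) + p ^ n,
      p ^ (2 * n + 1) + p ^ (n + 1),
      p ^ (2 * n + 1) + p ^ (n + 1) + 1]"

definition conductor :: "nat set \<Rightarrow> nat" where
  "conductor \<Gamma> = (LEAST c. \<forall>x\<ge>c. x \<in> \<Gamma>)"

definition genus :: "nat set \<Rightarrow> nat" where
  "genus \<Gamma> = card (- \<Gamma>)"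

definition divisor_set :: "nat set \<Rightarrow> nat \<Rightarrow> nat set" where
  "divisor_set \<Gamma> b = {c \<in> \<Gamma>. c \<le> b \<and> b - c \<in> \<Gamma>}"

text \<open>
  The second Feng-Rao distance. The infimum ranges over a nonempty set of natural numbers
  when \<open>\<Gamma>\<close> is a numerical semigroup, so it is attained.
\<close>

definition feng_rao2 :: "nat set \<Rightarrow> nat \<Rightarrow> nat" where
  "feng_rao2 \<Gamma> a =
     Inf {card (divisor_set \<Gamma> b1 \<union> divisor_set \<Gamma> b2) | b1 b2.
            b1 \<in> \<Gamma> \<and> b2 \<in> \<Gamma> \<and> a \<le> b1 \<and> b1 < b2}"

text \<open>
  The second Feng-Rao number \<open>E(\<Gamma>, 2)\<close>. It is given by its defining
  property; for a numerical semigroup it also equals the minimal size of the Apery sets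
  \<open>{a \<in> \<Gamma>. a - x \<notin> \<Gamma>}\<close> over positive integers \<open>x\<close>, where \<open>a - x\<close> is
  an integer difference.
\<close>

definition feng_rao_number2 :: "nat set \<Rightarrow> int" where
  "feng_rao_number2 \<Gamma> =
     (THE e. \<forall>a::nat. int a \<ge> 2 * int (conductor \<Gamma>) - 1 \<longrightarrow>
        int (feng_rao2 \<Gamma> a) = int a + 1 - 2 * int (genus \<Gamma>) + e)"

end

theory Submission imports Defs begin

text \<open>
  For \<open>b\<close> large, \<open>D(b + x) - D(b)\<close> is the reflection of the Apery set of \<open>x\<close>, so the second
  Feng--Rao number is the minimal size of an Apery set. Put \<open>q = p\<^sup>n\<close> and \<open>m = p q\<^sup>2\<close>. Every integer
  has a unique normal form \<open>a m + i (m + q) + j (m + p q) + l (m + p q + 1)\<close> with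
  \<open>0 \<le> i < p\<close> and \<open>0 \<le> j, l < q\<close>, and it lies in the semigroup iff \<open>a \<ge> 0\<close>. Subtracting normal
  forms is a subtraction with borrows, by the relations
  \<open>q (m + p q + 1) = q m + (m + q)\<close>, \<open>p (m + q) = (p - 1) m + (m + p q)\<close> and
  \<open>q (m + p q) = (q + 1) m\<close>; counting digits by their borrow pattern gives a closed formula for the
  size of every Apery set. That size is at least \<open>x\<close>, so only \<open>0 < x < m\<close> needs an estimate, and
  the minimum is attained at \<open>x = q\<close>.
\<close>

section \<open>The second Feng--Rao number and Apery sets\<close>

definition apery :: "nat set \<Rightarrow> nat \<Rightarrow> nat set" where
  "apery \<Gamma> x = {a \<in> \<Gamma>. x \<le> a \<longrightarrow> a - x \<notin> \<Gamma>}"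

lemma conductor_mem:
  assumes "finite (- \<Gamma>)" and "conductor \<Gamma> \<le> x"
  shows "x \<in> \<Gamma>"
proof -
  obtain b where "\<forall>x\<in>-\<Gamma>. x < b"
    using assms(1) finite_nat_set_iff_bounded by blast
  then have "\<forall>x\<ge>b. x \<in> \<Gamma>"
    by (meson ComplI not_less)
  then have "\<forall>x\<ge>conductor \<Gamma>. x \<in> \<Gamma>"
    unfolding conductor_def by (rule LeastI)
  with assms(2) show ?thesis
    by blast
qed

lemma divisor_set_subset: "divisor_set \<Gamma> b \<subseteq> {..b}"
  by (auto simp: divisor_set_def)

lemma finite_divisor_set: "finite (divisor_set \<Gamma> b)"
  using divisor_set_subset finite_subset by blast

text \<open>The non-divisors up to \<open>b\<close> are the gaps and their reflections
  \<open>b - x\<close>. The two families are disjoint because two gaps add up to at most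
  \<open>2 * conductor \<Gamma> - 2\<close>, which is less than \<open>b\<close>.\<close>

lemma card_divisor_set:
  assumes fin: "finite (- \<Gamma>)" and b: "2 * conductor \<Gamma> \<le> b + 1"
  shows "card (divisor_set \<Gamma> b) + 2 * genus \<Gamma> = b + 1"
proof -
  let ?G = "- \<Gamma>"
  let ?H = "(\<lambda>x. b - x) ` ?G"
  have lt: "x < conductor \<Gamma>" if "x \<in> ?G" for x
    using conductor_mem[OF fin] that by (meson ComplD not_less)
  have le: "x \<le> b" if "x \<in> ?G" for x
    using lt[OF that] b by linarith
  have "{..b} = divisor_set \<Gamma> b \<union> (?G \<union> ?H)"
  proof (intro equalityI subsetI)
    fix x assume x: "x \<in> {..b}"
    show "x \<in> divisor_set \<Gamma> b \<union> (?G \<union> ?H)"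
    proof (cases "x \<in> \<Gamma> \<and> b - x \<in> \<Gamma>")
      case False
      moreover have "x = b - (b - x)"
        using x by simp
      ultimately show ?thesis
        by blast
    qed (use x in \<open>auto simp: divisor_set_def\<close>)
  qed (use le in \<open>auto simp: divisor_set_def\<close>)
  moreover have "divisor_set \<Gamma> b \<inter> (?G \<union> ?H) = {}"
    using le by (auto simp: divisor_set_def)
  moreover have "?G \<inter> ?H = {}"
  proof (rule ccontr)
    assume "?G \<inter> ?H \<noteq> {}"
    then obtain x where "b - x \<in> ?G" "x \<in> ?G"
      by blast
    then have "b - x < conductor \<Gamma>" "x < conductor \<Gamma>"
      using lt by auto
    with b show False
      by linarith
  qed
  moreover have "card ?H = card ?G"
    by (rule card_image) (metis (no_types, lifting) diff_diff_cancel inj_onI le)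
  ultimately show ?thesis
    using fin finite_divisor_set[of \<Gamma> b] card_atMost[of b]
    by (simp add: card_Un_disjoint genus_def)
qed

text \<open>The reflection \<open>c \<mapsto> b + x - c\<close> turns \<open>b - c\<close> into
  \<open>d - x\<close>, so it matches the new divisors with the Apery set of
  \<open>x\<close>.\<close>

lemma card_divisor_set_Un:
  assumes fin: "finite (- \<Gamma>)" and b: "2 * conductor \<Gamma> \<le> b + 1"
  shows "card (divisor_set \<Gamma> b \<union> divisor_set \<Gamma> (b + x)) =
    card (divisor_set \<Gamma> b) + card (apery \<Gamma> x)"
proof -
  let ?R = "(\<lambda>d. b + x - d) ` apery \<Gamma> x"
  \<comment> \<open>Apery elements lie below \<open>x + conductor \<Gamma>\<close>, so their
    reflections are non-negative and their complements reach the conductor.\<close>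
  have bound: "d \<le> b + x \<and> b + x - d \<in> \<Gamma>" if d: "d \<in> apery \<Gamma> x" for d
  proof -
    have "d < x + conductor \<Gamma>"
    proof (rule ccontr)
      assume "\<not> d < x + conductor \<Gamma>"
      then have "x \<le> d" "conductor \<Gamma> \<le> d - x"
        by linarith+
      with d conductor_mem[OF fin] show False
        by (auto simp: apery_def)
    qed
    then have "d \<le> b + x" "conductor \<Gamma> \<le> b + x - d"
      using b by linarith+
    with conductor_mem[OF fin] show ?thesis
      by blast
  qed
  have "divisor_set \<Gamma> (b + x) - divisor_set \<Gamma> b = ?R"
  proof (intro equalityI subsetI)
    fix c assume c: "c \<in> divisor_set \<Gamma> (b + x) - divisor_set \<Gamma> b"
    have "b + x - c \<in> apery \<Gamma> x"
      using c by (auto simp: divisor_set_def apery_def)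
    moreover have "c = b + x - (b + x - c)"
      using c by (auto simp: divisor_set_def)
    ultimately show "c \<in> ?R"
      by blast
  next
    fix c assume "c \<in> ?R"
    then obtain d where d: "d \<in> apery \<Gamma> x" "c = b + x - d"
      by blast
    have "c \<le> b \<Longrightarrow> x \<le> d \<and> b - c = d - x"
      using bound[OF d(1)] d(2) by linarith
    with bound[OF d(1)] d show "c \<in> divisor_set \<Gamma> (b + x) - divisor_set \<Gamma> b"
      by (auto simp: divisor_set_def apery_def)
  qed
  moreover have "card ?R = card (apery \<Gamma> x)"
    by (rule card_image) (metis (no_types, lifting) diff_diff_cancel inj_onI bound)
  ultimately show ?thesis
    using finite_divisor_set
    by (metis Un_Diff_cancel card_Un_disjoint Diff_disjoint finite_Diff)
qed

text \<open>For admissible \<open>b1\<close> the cardinality is \<open>b1 + 1 - 2g\<close> (with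
  \<open>g\<close> the genus) plus the size of the Apery set of \<open>b2 - b1\<close>. The two
  terms are minimised independently, at \<open>b1 = a\<close> and
  \<open>b2 - b1 = x0\<close>.\<close>

lemma feng_rao2_eq:
  assumes fin: "finite (- \<Gamma>)"
    and lower: "\<And>x. 0 < x \<Longrightarrow> N \<le> card (apery \<Gamma> x)"
    and x0: "0 < x0" "card (apery \<Gamma> x0) = N"
    and a: "2 * conductor \<Gamma> \<le> a + 1"
  shows "feng_rao2 \<Gamma> a + 2 * genus \<Gamma> = a + 1 + N"
proof -
  let ?A = "{card (divisor_set \<Gamma> b1 \<union> divisor_set \<Gamma> b2) | b1 b2.
            b1 \<in> \<Gamma> \<and> b2 \<in> \<Gamma> \<and> a \<le> b1 \<and> b1 < b2}"
  let ?M = "card (divisor_set \<Gamma> a) + N"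
  have mem: "b \<in> \<Gamma>" if "a \<le> b" for b
  proof (rule conductor_mem[OF fin])
    show "conductor \<Gamma> \<le> b"
      using a that by linarith
  qed
  have "feng_rao2 \<Gamma> a = ?M"
    unfolding feng_rao2_def
  proof (rule cInf_eq_minimum)
    have "?M = card (divisor_set \<Gamma> a \<union> divisor_set \<Gamma> (a + x0))"
      using card_divisor_set_Un[OF fin a] x0 by simp
    with mem[of a] mem[of "a + x0"] x0(1) show "?M \<in> ?A"
      by force
  next
    fix y assume "y \<in> ?A"
    then obtain b1 b2 where y: "y = card (divisor_set \<Gamma> b1 \<union> divisor_set \<Gamma> b2)"
      and b: "a \<le> b1" "b1 < b2"
      by blast
    have c: "2 * conductor \<Gamma> \<le> b1 + 1"
      using a b by linarith
    have "y = card (divisor_set \<Gamma> b1) + card (apery \<Gamma> (b2 - b1))"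
      using card_divisor_set_Un[OF fin c, of "b2 - b1"] b y by simp
    with lower[of "b2 - b1"] card_divisor_set[OF fin a] card_divisor_set[OF fin c] b
    show "?M \<le> y"
      by simp
  qed
  with card_divisor_set[OF fin a] show ?thesis
    by simp
qed

lemma feng_rao_number2_eqI:
  assumes fin: "finite (- \<Gamma>)"
    and lower: "\<And>x. 0 < x \<Longrightarrow> N \<le> card (apery \<Gamma> x)"
    and x0: "0 < x0" "card (apery \<Gamma> x0) = N"
  shows "feng_rao_number2 \<Gamma> = int N"
  unfolding feng_rao_number2_def
proof (rule the_equality)
  have eq: "int (feng_rao2 \<Gamma> a) = int a + 1 - 2 * int (genus \<Gamma>) + int N"
    if "int a \<ge> 2 * int (conductor \<Gamma>) - 1" for a
    using feng_rao2_eq[OF fin lower x0, of a] that by linarith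
  then show "\<forall>a. int a \<ge> 2 * int (conductor \<Gamma>) - 1 \<longrightarrow>
      int (feng_rao2 \<Gamma> a) = int a + 1 - 2 * int (genus \<Gamma>) + int N"
    by blast
  fix e
  assume e: "\<forall>a. int a \<ge> 2 * int (conductor \<Gamma>) - 1 \<longrightarrow>
      int (feng_rao2 \<Gamma> a) = int a + 1 - 2 * int (genus \<Gamma>) + e"
  \<comment> \<open>A single admissible argument already determines \<open>e\<close>.\<close>
  have "int (2 * conductor \<Gamma>) \<ge> 2 * int (conductor \<Gamma>) - 1"
    by simp
  with e eq[of "2 * conductor \<Gamma>"] show "e = int N"
    by fastforce
qed

section \<open>Normal forms and the size of the Apery sets\<close>

lemma sum_threshold:
  fixes N J A B :: int
  assumes "0 \<le> J" "J \<le> N"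
  shows "(\<Sum>j\<in>{0..<N}. if j < J then A else B) = J * A + (N - J) * B"
proof -
  have "{0..<N} = {0..<J} \<union> {J..<N}"
    using assms by auto
  then have "(\<Sum>j\<in>{0..<N}. if j < J then A else B) =
      (\<Sum>j\<in>{0..<J}. if j < J then A else B) + (\<Sum>j\<in>{J..<N}. if j < J then A else B)"
    by (simp add: sum.union_disjoint)
  also have "\<dots> = (\<Sum>j\<in>{0..<J}. A) + (\<Sum>j\<in>{J..<N}. B)"
    by (intro arg_cong2[where f = "(+)"] sum.cong) auto
  finally show ?thesis
    using assms by simp
qed

text \<open>Here \<open>q\<close> stands for \<open>p\<^sup>n\<close>, so that the multiplicity is \<open>m = p q\<^sup>2\<close>.\<close>

locale suzuki_params =
  fixes p q :: int
  assumes p2: "2 \<le> p" and pq: "p \<le> q"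
begin

section \<open>Normal forms of integers\<close>

definition m :: int where "m = p * q * q"

definition val :: "int \<Rightarrow> int \<Rightarrow> int \<Rightarrow> int \<Rightarrow> int" where
  "val a i j l = a * m + i * (m + q) + j * (m + p * q) + l * (m + p * q + 1)"

definition digits :: "int \<Rightarrow> int \<Rightarrow> int \<Rightarrow> bool" where
  "digits i j l \<longleftrightarrow> 0 \<le> i \<and> i < p \<and> 0 \<le> j \<and> j < q \<and> 0 \<le> l \<and> l < q"

text \<open>Defined by normal forms so that membership is a sign condition on \<open>a\<close>;
  \<open>mem_sg_iff\<close> identifies it with the semigroup of the four generators.\<close>

definition sg :: "int set" where
  "sg = {val a i j l | a i j l. 0 \<le> a \<and> digits i j l}"

text \<open>
  Subtracting \<open>val (- b) i j l\<close> with borrow indicators \<open>bl\<close>, \<open>bi\<close>, \<open>bj\<close> out of the three digits lowers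
  the leading coefficient by \<open>q bl + (p - 1) bi + (q + 1) bj - b\<close>; the number of elements of the
  Apery set with given digits is the positive part of this drop.
\<close>

definition borrow_ap :: "int \<Rightarrow> int \<Rightarrow> int \<Rightarrow> int \<Rightarrow> int" where
  "borrow_ap b bl bi bj = max 0 (q * bl + (p - 1) * bi + (q + 1) * bj - b)"

lemma q2: "2 \<le> q"
  using p2 pq by simp

text \<open>A mixed radix expansion with bases \<open>q\<close>, \<open>p\<close>, \<open>q\<close>,
  except that its third entry \<open>j + l\<close> can exceed \<open>q - 1\<close>. Existence and
  uniqueness of normal forms follow by repeated division with remainder.\<close>

lemma val_horner: "val a i j l = l + q * (i + p * (j + l + q * (a + i + j + l)))"
  by (simp add: val_def m_def algebra_simps)

lemma val_inj:
  assumes "digits i j l" "digits i' j' l'" "val a i j l = val a' i' j' l'"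
  shows "a = a' \<and> i = i' \<and> j = j' \<and> l = l'"
proof -
  have step: "u = u' \<and> v = v'" if "0 \<le> u" "u < d" "0 \<le> u'" "u' < d" "u + d * v = u' + d * v'"
    for u u' v v' d :: int
  proof -
    have "(w + d * t) mod d = w" if "0 \<le> w" "w < d" for w t
      using that by simp
    with that have "u = u'"
      by metis
    with that show ?thesis
      by simp
  qed
  have 1: "l = l' \<and> i + p * (j + l + q * (a + i + j + l)) = i' + p * (j' + l' + q * (a' + i' + j' + l'))"
    using assms unfolding val_horner digits_def by (intro step[of _ q]) auto
  have 2: "i = i' \<and> j + l + q * (a + i + j + l) = j' + l' + q * (a' + i' + j' + l')"
    using assms 1 unfolding digits_def by (intro step[of _ p]) auto
  have 3: "j = j' \<and> a + i + j + l = a' + i' + j' + l'"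
    using assms 1 2 unfolding digits_def by (intro step[of _ q]) auto
  from 1 2 3 show ?thesis
    by simp
qed

lemma val_surj: "\<exists>a i j l. digits i j l \<and> z = val a i j l"
proof -
  define l where "l = z mod q"
  define i where "i = z div q mod p"
  define Y where "Y = z div q div p"
  \<comment> \<open>The third Horner entry is \<open>j + l\<close>, hence the correction by
    \<open>l\<close>.\<close>
  define j where "j = (Y - l) mod q"
  define a where "a = (Y - l) div q - i - j - l"
  have "Y = j + l + q * (a + i + j + l)"
    unfolding a_def j_def by simp
  then have "z = val a i j l"
    unfolding val_horner by (metis l_def i_def Y_def mod_mult_div_eq)
  moreover have "digits i j l"
    using p2 q2 by (simp add: digits_def l_def i_def j_def)
  ultimately show ?thesis
    by blast
qed

lemma val_mem_sg:
  assumes "digits i j l"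
  shows "val a i j l \<in> sg \<longleftrightarrow> 0 \<le> a"
  unfolding sg_def using assms val_inj by blast

lemma sg_nonneg: "z \<in> sg \<Longrightarrow> 0 \<le> z"
  using p2 q2 by (auto simp: sg_def digits_def val_def m_def)

section \<open>Borrows and exact Apery set sizes\<close>

lemma val_diff:
  "val a i' j' l' - val (- b) i j l =
    val (a - (q * bl + (p - 1) * bi + (q + 1) * bj - b))
      (i' - i - bl + p * bi) (j' - j - bi + q * bj) (l' - l + q * bl)"
  by (simp add: val_def m_def algebra_simps)

text \<open>The identity \<open>val_diff\<close> holds for arbitrary borrows; these are the ones
  that bring every digit back into range, so that the leading coefficient of the difference decides
  membership.\<close>

lemma digits_diff:
  assumes "digits i j l" "digits i' j' l'"
    and "bl = of_bool (l' < l)" "bi = of_bool (i' < i + bl)" "bj = of_bool (j' < j + bi)"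
  shows "digits (i' - i - bl + p * bi) (j' - j - bi + q * bj) (l' - l + q * bl)"
  using assms unfolding digits_def of_bool_def by (auto split: if_splits)

text \<open>Over fixed digits the difference leaves \<open>sg\<close> iff \<open>a\<close> is below
  the drop, so each fibre is an interval starting at 0; \<open>val_inj\<close> keeps the fibres
  disjoint.\<close>

lemma card_sg_diff_sum:
  assumes d: "digits i j l"
  shows "int (card {s \<in> sg. s - val (- b) i j l \<notin> sg}) =
    (\<Sum>l'\<in>{0..<q}. \<Sum>i'\<in>{0..<p}. \<Sum>j'\<in>{0..<q}.
      let bl = of_bool (l' < l); bi = of_bool (i' < i + bl) in
      borrow_ap b bl bi (of_bool (j' < j + bi)))"
proof -
  define K where "K = (\<lambda>(l', i', j').
    let bl = of_bool (l' < l); bi = of_bool (i' < i + bl) in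
    borrow_ap b bl bi (of_bool (j' < j + bi)))"
  let ?W = "{0..<q} \<times> {0..<p} \<times> {0..<q}"
  let ?V = "\<lambda>((l', i', j'), a). val a i' j' l'"
  have mem: "val a i' j' l' - val (- b) i j l \<notin> sg \<longleftrightarrow> a < K (l', i', j')"
    if "digits i' j' l'" "0 \<le> a" for a i' j' l'
  proof -
    define bl bi bj :: int where bs: "bl = of_bool (l' < l)" "bi = of_bool (i' < i + bl)"
      "bj = of_bool (j' < j + bi)"
    show ?thesis
      unfolding val_diff[of a i' j' l' b i j l bl bi bj] val_mem_sg[OF digits_diff[OF d that(1) bs]]
      using that(2) by (auto simp: K_def borrow_ap_def Let_def bs)
  qed
  have "{s \<in> sg. s - val (- b) i j l \<notin> sg} = ?V ` (SIGMA w:?W. {0..<K w})"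
  proof (intro equalityI subsetI)
    fix s assume s: "s \<in> {s \<in> sg. s - val (- b) i j l \<notin> sg}"
    then obtain a i' j' l' where sv: "s = val a i' j' l'" "0 \<le> a" "digits i' j' l'"
      by (auto simp: sg_def)
    with s mem have "((l', i', j'), a) \<in> (SIGMA w:?W. {0..<K w})"
      by (auto simp: digits_def)
    then show "s \<in> ?V ` (SIGMA w:?W. {0..<K w})"
      using sv by force
  next
    fix s assume "s \<in> ?V ` (SIGMA w:?W. {0..<K w})"
    then obtain a i' j' l' where sv: "s = val a i' j' l'" "0 \<le> a" "digits i' j' l'" "a < K (l', i', j')"
      by (auto simp: digits_def)
    with mem show "s \<in> {s \<in> sg. s - val (- b) i j l \<notin> sg}"
      by (auto simp: val_mem_sg)
  qed
  moreover have "inj_on ?V (SIGMA w:?W. {0..<K w})"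
  proof (rule inj_onI)
    fix u v
    assume u: "u \<in> (SIGMA w:?W. {0..<K w})" and v: "v \<in> (SIGMA w:?W. {0..<K w})"
      and eq: "?V u = ?V v"
    obtain l1 i1 j1 a1 l2 i2 j2 a2 where uv: "u = ((l1, i1, j1), a1)" "v = ((l2, i2, j2), a2)"
      by (metis surj_pair)
    have "digits i1 j1 l1" "digits i2 j2 l2"
      using u v by (auto simp: uv digits_def)
    moreover have "val a1 i1 j1 l1 = val a2 i2 j2 l2"
      using eq by (simp add: uv)
    ultimately show "u = v"
      using val_inj unfolding uv by blast
  qed
  ultimately have "card {s \<in> sg. s - val (- b) i j l \<notin> sg} = card (SIGMA w:?W. {0..<K w})"
    by (simp add: card_image)
  also have "\<dots> = (\<Sum>w\<in>?W. nat (K w))"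
    by simp
  finally have "int (card {s \<in> sg. s - val (- b) i j l \<notin> sg}) = (\<Sum>w\<in>?W. int (nat (K w)))"
    by simp
  also have "\<dots> = (\<Sum>w\<in>?W. K w)"
    by (rule sum.cong) (auto simp: K_def borrow_ap_def Let_def)
  finally show ?thesis
    by (simp add: sum.cartesian_product K_def)
qed

text \<open>
  The coefficient of \<open>B bl bi bj\<close> is the number of digit triples with that borrow pattern. Borrows
  propagate from \<open>l\<close> to \<open>i\<close> to \<open>j\<close>.
\<close>

definition borrow_sum :: "(int \<Rightarrow> int \<Rightarrow> int \<Rightarrow> int) \<Rightarrow> int \<Rightarrow> int \<Rightarrow> int \<Rightarrow> int" where
  "borrow_sum B i j l =
    (q - l) * ((p - i) * ((q - j) * B 0 0 0 + j * B 0 0 1)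
             + i * ((q - j - 1) * B 0 1 0 + (j + 1) * B 0 1 1))
    + l * ((p - i - 1) * ((q - j) * B 1 0 0 + j * B 1 0 1)
             + (i + 1) * ((q - j - 1) * B 1 1 0 + (j + 1) * B 1 1 1))"

lemma card_sg_diff:
  assumes d: "digits i j l"
  shows "int (card {s \<in> sg. s - val (- b) i j l \<notin> sg}) = borrow_sum (borrow_ap b) i j l"
proof -
  \<comment> \<open>\<open>J\<close> and \<open>I\<close> are the values of the inner sums over
    \<open>j'\<close> and \<open>i'\<close>; an incoming borrow raises the threshold by one.\<close>
  define J where "J = (\<lambda>bl bi. (j + bi) * borrow_ap b bl bi 1 + (q - (j + bi)) * borrow_ap b bl bi 0)"
  define I where "I = (\<lambda>bl. (i + bl) * J bl 1 + (p - (i + bl)) * J bl 0)"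
  have J: "(\<Sum>j'\<in>{0..<q}. borrow_ap b bl bi (of_bool (j' < j + bi))) = J bl bi"
    if "bi \<in> {0, 1}" for bl bi
  proof -
    have "(\<Sum>j'\<in>{0..<q}. borrow_ap b bl bi (of_bool (j' < j + bi))) =
      (\<Sum>j'\<in>{0..<q}. if j' < j + bi then borrow_ap b bl bi 1 else borrow_ap b bl bi 0)"
      by (rule sum.cong) auto
    also have "\<dots> = J bl bi"
      unfolding J_def using d that by (intro sum_threshold) (auto simp: digits_def)
    finally show ?thesis .
  qed
  have I: "(\<Sum>i'\<in>{0..<p}. J bl (of_bool (i' < i + bl))) = I bl"
    if "bl \<in> {0, 1}" for bl
  proof -
    have "(\<Sum>i'\<in>{0..<p}. J bl (of_bool (i' < i + bl))) =
      (\<Sum>i'\<in>{0..<p}. if i' < i + bl then J bl 1 else J bl 0)"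
      by (rule sum.cong) auto
    also have "\<dots> = I bl"
      unfolding I_def using d that by (intro sum_threshold) (auto simp: digits_def)
    finally show ?thesis .
  qed
  have "int (card {s \<in> sg. s - val (- b) i j l \<notin> sg}) = (\<Sum>l'\<in>{0..<q}. I (of_bool (l' < l)))"
    unfolding card_sg_diff_sum[OF d] Let_def by (simp add: I J)
  also have "\<dots> = (\<Sum>l'\<in>{0..<q}. if l' < l then I 1 else I 0)"
    by (rule sum.cong) auto
  also have "\<dots> = l * I 1 + (q - l) * I 0"
    using d by (intro sum_threshold) (auto simp: digits_def)
  finally show ?thesis
    by (simp add: I_def J_def borrow_sum_def algebra_simps)
qed

section \<open>Lower bounds for Apery set sizes\<close>

lemma borrow_sum_mono:
  assumes "digits i j l" and "\<And>bl bi bj. B bl bi bj \<le> C bl bi bj"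
  shows "borrow_sum B i j l \<le> borrow_sum C i j l"
  unfolding borrow_sum_def using assms
  by (intro add_mono mult_left_mono) (auto simp: digits_def)

text \<open>Without truncation at 0 the weighted sum of the drops is exactly the subtracted
  number.\<close>

lemma val_le_borrow_sum:
  assumes "digits i j l"
  shows "val (- b) i j l \<le> borrow_sum (borrow_ap b) i j l"
proof -
  have "borrow_sum (\<lambda>bl bi bj. q * bl + (p - 1) * bi + (q + 1) * bj - b) i j l
      \<le> borrow_sum (borrow_ap b) i j l"
    by (rule borrow_sum_mono[OF assms]) (simp add: borrow_ap_def)
  moreover have "borrow_sum (\<lambda>bl bi bj. q * bl + (p - 1) * bi + (q + 1) * bj - b) i j l
      = val (- b) i j l"
    by (simp add: borrow_sum_def val_def m_def algebra_simps)
  ultimately show ?thesis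
    by simp
qed

text \<open>Only the pattern without borrows is truncated: its drop \<open>- b\<close> becomes 0 for
  \<open>(q - l) * (p - i) * (q - j)\<close> digit triples.\<close>

lemma borrow_sum_ge_no_carry:
  assumes "digits i j l"
  shows "val (- b) i j l + (q - l) * (p - i) * (q - j) * b \<le> borrow_sum (borrow_ap b) i j l"
proof -
  let ?B = "\<lambda>bl bi bj. if bl = 0 \<and> bi = 0 \<and> bj = 0 then 0
    else q * bl + (p - 1) * bi + (q + 1) * bj - b"
  have "borrow_sum ?B i j l \<le> borrow_sum (borrow_ap b) i j l"
    by (rule borrow_sum_mono[OF assms]) (simp add: borrow_ap_def)
  moreover have "borrow_sum ?B i j l = val (- b) i j l + (q - l) * (p - i) * (q - j) * b"
    by (simp add: borrow_sum_def val_def m_def algebra_simps)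
  ultimately show ?thesis
    by simp
qed

text \<open>
  For \<open>0 < x < m\<close> the coefficient \<open>- b\<close> of \<open>x\<close> is \<open>- (i + j + l)\<close> if \<open>j + l < q\<close> and
  \<open>- (i + j + l + 1)\<close> otherwise. In the first case it suffices to truncate the term without borrows,
  in the second to keep the terms with borrows out of both \<open>l\<close> and \<open>j\<close>.
\<close>

lemma no_carry_bound:
  assumes "0 \<le> i" "i < p" "0 \<le> j" "0 \<le> l" "j + l < q" "0 < i + j + l"
  shows "p * q * q - q * q + q \<le>
    l + q * i + p * q * (j + l) + (q - l) * (p - i) * (q - j) * (i + j + l)"
proof -
  define K where "K = j + l"
  have K: "0 \<le> K" "K < q" "0 < i + K"
    using assms by (auto simp: K_def)
  \<comment> \<open>The difference of the two sides factors, and \<open>0 < i + K\<close> makes both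
    factors non-negative.\<close>
  have "p - 1 + K \<le> (p - i) * (i + K)"
  proof (cases "i = 0")
    case True
    then have "(p - i) * (i + K) - (p - 1 + K) = (p - 1) * (K - 1)"
      by (simp add: algebra_simps)
    moreover have "0 \<le> (p - 1) * (K - 1)"
      using True K p2 by (intro mult_nonneg_nonneg) auto
    ultimately show ?thesis
      by linarith
  next
    case False
    have "(p - i) * (i + K) - (p - 1 + K) = (p - 1 - i) * (i - 1 + K)"
      by (simp add: algebra_simps)
    moreover have "0 \<le> (p - 1 - i) * (i - 1 + K)"
      using False assms K by (intro mult_nonneg_nonneg) auto
    ultimately show ?thesis
      by linarith
  qed
  then have "(q - K) * (p - 1 + K) \<le> (q - K) * ((p - i) * (i + K))"
    using K by (intro mult_left_mono) auto
  moreover have "(q - K) * (p - 1 + K) + i + p * K = (p - 1) * q + (i + K) + K * (q - K)"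
    by (simp add: algebra_simps)
  moreover have "0 \<le> K * (q - K)"
    using K by simp
  ultimately have "(p - 1) * q + 1 \<le> i + p * K + (q - K) * ((p - i) * (i + K))"
    using K by linarith
  \<comment> \<open>The left side is the target value.\<close>
  then have "q * ((p - 1) * q + 1) \<le> q * (i + p * K + (q - K) * ((p - i) * (i + K)))"
    using q2 by (intro mult_left_mono) auto
  moreover have "q * (q - K) * ((p - i) * (i + K)) \<le> (q - l) * (q - j) * ((p - i) * (i + K))"
  proof (rule mult_right_mono)
    have "(q - l) * (q - j) - q * (q - K) = j * l"
      by (simp add: K_def algebra_simps)
    moreover have "0 \<le> j * l"
      using assms by simp
    ultimately show "q * (q - K) \<le> (q - l) * (q - j)"
      by linarith
  qed (use assms K in auto)
  ultimately show ?thesis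
    using assms(4) by (simp add: K_def algebra_simps)
qed

text \<open>Here the drop \<open>r = q - i - K\<close> for borrows out of \<open>l\<close> and
  \<open>j\<close> alone is non-negative, so it is kept next to the drop \<open>r + p - 1\<close>
  for all three borrows.\<close>

lemma carry_bound_small:
  assumes "0 \<le> i" "i < p" "0 \<le> K" "j < q" "l < q" "j + l = q + K" "i + K \<le> q"
  shows "p * q * q - q * q + q \<le>
    l * ((p - i - 1) * (j * (q - i - K)) + (i + 1) * ((j + 1) * (q + p - 1 - i - K)))"
proof -
  define r where "r = q - i - K"
  have r: "0 \<le> r" "r \<le> q"
    using assms by (auto simp: r_def)
  have pos: "0 \<le> (p - 1) * q" "0 \<le> (i + 1) * (p - 1)" "0 \<le> p * r" "0 \<le> (i + 1) * r"
    "0 \<le> p * (q - 1)" "0 \<le> (p - 1) * q + r"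
    using p2 q2 assms r by auto
  \<comment> \<open>With the sum \<open>q + K\<close> fixed, the product of two digits is least when
    they are \<open>q - 1\<close> and \<open>K + 1\<close>.\<close>
  have "l * j - (K + 1) * (q - 1) = (q - 1 - j) * (j - K - 1)"
  proof -
    have "l = q + K - j"
      using assms by simp
    show ?thesis
      unfolding \<open>l = q + K - j\<close> by (simp add: algebra_simps)
  qed
  moreover have "0 \<le> (q - 1 - j) * (j - K - 1)"
    using assms by (intro mult_nonneg_nonneg) auto
  ultimately have lj: "(K + 1) * (q - 1) \<le> l * j"
    by linarith
  have l: "K + 1 \<le> l"
    using assms by simp
  have lj1: "(K + 1) * q \<le> l * (j + 1)"
    using lj l by (simp add: algebra_simps)
  have Kr: "r \<le> (K + 1) * r"
    using assms(3) r by (simp add: algebra_simps)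
  have Ki: "q - r + 1 \<le> (K + 1) * (i + 1)"
    using assms(1,3) by (simp add: r_def algebra_simps)
  \<comment> \<open>The inequality left once \<open>Kr\<close> and \<open>Ki\<close> have eliminated
    \<open>K\<close> and \<open>i\<close>; it uses \<open>p \<le> q\<close>.\<close>
  have "p * q * q - q * q + q \<le> p * (q - 1) * r + ((p - 1) * q + r) * (q - r + 1)"
  proof -
    have "p * (q - 1) * r + ((p - 1) * q + r) * (q - r + 1)
      = (p * q * q - q * q + q) + (p - 2) * q + r * (q - p) + r * (q - r + 1)"
      by (simp add: algebra_simps)
    moreover have "0 \<le> (p - 2) * q" "0 \<le> r * (q - p)" "0 \<le> r * (q - r + 1)"
      using p2 q2 pq r by auto
    ultimately show ?thesis
      by linarith
  qed
  also have "\<dots> \<le> p * (q - 1) * ((K + 1) * r) + ((p - 1) * q + r) * ((K + 1) * (i + 1))"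
    using pos Kr Ki by (intro add_mono mult_left_mono) auto
  also have "\<dots> = p * r * ((K + 1) * (q - 1)) + (i + 1) * (p - 1) * ((K + 1) * q) + (i + 1) * r * (K + 1)"
    by (simp add: algebra_simps)
  also have "\<dots> \<le> p * r * (l * j) + (i + 1) * (p - 1) * (l * (j + 1)) + (i + 1) * r * l"
    using pos lj lj1 l by (intro add_mono mult_left_mono) auto
  also have "\<dots> = l * ((p - i - 1) * (j * (q - i - K)) + (i + 1) * ((j + 1) * (q + p - 1 - i - K)))"
    by (simp add: r_def algebra_simps)
  finally show ?thesis .
qed

text \<open>Now \<open>q - i - K\<close> is negative, and the pattern with all three borrows
  suffices.\<close>

lemma carry_bound_large:
  assumes "0 \<le> i" "i < p" "0 \<le> K" "j < q" "l < q" "j + l = q + K" "q < i + K"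
  shows "p * q * q - q * q + q \<le> l * ((i + 1) * ((j + 1) * (q + p - 1 - i - K)))"
proof -
  define A B where "A = p - 1 - i" and "B = q - K"
  have AB: "0 \<le> A" "2 \<le> B" "A + B \<le> p - 2" "B \<le> q"
    using assms by (auto simp: A_def B_def)
  have "l * (j + 1) - (K + 1) * q = (q - 1 - j) * (j - K)"
  proof -
    have "l = q + K - j"
      using assms by simp
    show ?thesis
      unfolding \<open>l = q + K - j\<close> by (simp add: algebra_simps)
  qed
  moreover have "0 \<le> (q - 1 - j) * (j - K)"
    using assms by (intro mult_nonneg_nonneg) auto
  ultimately have lj1: "(K + 1) * q \<le> l * (j + 1)"
    by linarith
  have "B * (q - B + 1) - q = (B - 1) * (q - B)"
    by (simp add: algebra_simps)
  moreover have "0 \<le> (B - 1) * (q - B)"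
    using AB by simp
  ultimately have BC: "q \<le> B * (q - B + 1)"
    by linarith
  \<comment> \<open>In terms of \<open>A\<close> and \<open>B\<close> the drop is
    \<open>A + B\<close>. For \<open>A \<ge> 1\<close> the factor \<open>(p - A) * (A + B)\<close>
    is at least its value at \<open>A = 1\<close>, because \<open>A + B \<le> p - 2\<close>.\<close>
  have "p * q - q + 1 \<le> (q - B + 1) * ((p - A) * (A + B))"
  proof (cases "A = 0")
    case True
    have "p * q \<le> p * (B * (q - B + 1))"
      using BC p2 by (intro mult_left_mono) auto
    with True q2 show ?thesis
      by (simp add: algebra_simps)
  next
    case False
    have "(p - A) * (A + B) - (p - 1) * (B + 1) = (A - 1) * (p - A - 1 - B)"
      by (simp add: algebra_simps)
    moreover have "0 \<le> (A - 1) * (p - A - 1 - B)"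
      using AB False by (intro mult_nonneg_nonneg) auto
    ultimately have "(p - 1) * (B + 1) \<le> (p - A) * (A + B)"
      by linarith
    then have "(q - B + 1) * ((p - 1) * (B + 1)) \<le> (q - B + 1) * ((p - A) * (A + B))"
      using AB by (intro mult_left_mono) auto
    moreover have "(p - 1) * (q + 1) \<le> (p - 1) * (B * (q - B + 1) + (q - B + 1))"
      using BC AB p2 by (intro mult_left_mono) auto
    ultimately show ?thesis
      using p2 by (simp add: algebra_simps)
  qed
  then have "q * (p * q - q + 1) \<le> q * ((q - B + 1) * ((p - A) * (A + B)))"
    using q2 by (intro mult_left_mono) auto
  also have "\<dots> = (K + 1) * q * ((i + 1) * (q + p - 1 - i - K))"
    by (simp add: A_def B_def algebra_simps)
  also have "\<dots> \<le> l * (j + 1) * ((i + 1) * (q + p - 1 - i - K))"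
    using lj1 AB assms by (intro mult_right_mono mult_nonneg_nonneg) (auto simp: A_def B_def)
  finally show ?thesis
    by (simp add: algebra_simps)
qed

text \<open>The value \<open>i + K + q + 1\<close> is \<open>i + j + l + 1\<close>. All terms are
  non-negative after truncation, so unwanted borrow patterns can be replaced by 0.\<close>

lemma carry_bound:
  assumes d: "digits i j l" and K: "0 \<le> K" "j + l = q + K"
  shows "p * q * q - q * q + q \<le> borrow_sum (borrow_ap (i + K + q + 1)) i j l"
proof (cases "i + K \<le> q")
  case True
  let ?B = "\<lambda>bl bi bj. if bl = 1 \<and> bj = 1
    then q * bl + (p - 1) * bi + (q + 1) * bj - (i + K + q + 1) else 0"
  have "borrow_sum ?B i j l \<le> borrow_sum (borrow_ap (i + K + q + 1)) i j l"
    by (rule borrow_sum_mono[OF d]) (simp add: borrow_ap_def)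
  moreover have "borrow_sum ?B i j l =
      l * ((p - i - 1) * (j * (q - i - K)) + (i + 1) * ((j + 1) * (q + p - 1 - i - K)))"
    by (simp add: borrow_sum_def algebra_simps)
  ultimately show ?thesis
    using carry_bound_small[of i K j l] d K True by (simp add: digits_def)
next
  case False
  let ?B = "\<lambda>bl bi bj. if bl = 1 \<and> bi = 1 \<and> bj = 1
    then q * bl + (p - 1) * bi + (q + 1) * bj - (i + K + q + 1) else 0"
  have "borrow_sum ?B i j l \<le> borrow_sum (borrow_ap (i + K + q + 1)) i j l"
    by (rule borrow_sum_mono[OF d]) (simp add: borrow_ap_def)
  moreover have "borrow_sum ?B i j l = l * ((i + 1) * ((j + 1) * (q + p - 1 - i - K)))"
    by (simp add: borrow_sum_def algebra_simps)
  ultimately show ?thesis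
    using carry_bound_large[of i K j l] d K False by (simp add: digits_def)
qed

lemma card_sg_diff_ge:
  assumes x: "0 < x"
  shows "p * q * q - q * q + q \<le> int (card {s \<in> sg. s - x \<notin> sg})"
proof -
  obtain a i j l where d: "digits i j l" and xa: "x = val a i j l"
    using val_surj by blast
  define b where "b = - a"
  have xb: "x = val (- b) i j l"
    by (simp add: xa b_def)
  have card: "int (card {s \<in> sg. s - x \<notin> sg}) = borrow_sum (borrow_ap b) i j l"
    unfolding xb by (rule card_sg_diff[OF d])
  show ?thesis
  proof (cases "m \<le> x")
    case True
    have "q * 1 \<le> q * q"
      using q2 by (intro mult_left_mono) auto
    with True val_le_borrow_sum[OF d, of b] show ?thesis
      unfolding card xb[symmetric] m_def by linarith
  next
    case False
    \<comment> \<open>\<open>e\<close> and \<open>Y\<close> are the top Horner coefficient and the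
      Horner entry below it with \<open>e\<close> absorbed. From \<open>0 < x < m\<close> follows
      \<open>0 \<le> Y < q\<close>, and then \<open>- e\<close> is the carry of
      \<open>j + l\<close>.\<close>
    define e where "e = i + j + l - b"
    define Y where "Y = j + l + q * e"
    have xY: "x = l + q * (i + p * Y)"
      unfolding xb val_horner Y_def e_def by simp
    have Y0: "0 \<le> Y"
    proof (rule ccontr)
      assume "\<not> 0 \<le> Y"
      then have "p * Y \<le> p * (- 1)"
        using p2 by (intro mult_left_mono) auto
      then have "q * (i + p * Y) \<le> q * (- 1)"
        using q2 d by (intro mult_left_mono) (auto simp: digits_def)
      with x d show False
        unfolding xY digits_def by simp
    qed
    have Yq: "Y < q"
    proof (rule ccontr)
      assume "\<not> Y < q"
      then have "p * q \<le> p * Y"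
        using p2 by (intro mult_left_mono) auto
      then have "p * q \<le> i + p * Y"
        using d unfolding digits_def by linarith
      then have "q * (p * q) \<le> q * (i + p * Y)"
        using q2 by (intro mult_left_mono) auto
      with False d show False
        unfolding xY digits_def m_def by (simp add: algebra_simps)
    qed
    have "e < 1"
    proof (rule ccontr)
      assume "\<not> e < 1"
      then have "q * 1 \<le> q * e"
        using q2 by (intro mult_left_mono) auto
      with Yq d show False
        unfolding Y_def digits_def by linarith
    qed
    moreover have "- 2 < e"
    proof (rule ccontr)
      assume "\<not> - 2 < e"
      then have "q * e \<le> q * (- 2)"
        using q2 by (intro mult_left_mono) auto
      with Y0 d show False
        by (simp add: Y_def digits_def)
    qed
    ultimately consider "e = 0" | "e = - 1"
      by linarith
    then show ?thesis
    proof cases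
      case 1
      then have b: "b = i + j + l" and jl: "Y = j + l"
        by (auto simp: e_def Y_def)
      have "0 < i + j + l"
      proof (rule ccontr)
        assume "\<not> 0 < i + j + l"
        with d have "i = 0" "j = 0" "l = 0"
          by (auto simp: digits_def)
        with x show False
          by (simp add: xY jl)
      qed
      then have "p * q * q - q * q + q \<le>
          l + q * i + p * q * (j + l) + (q - l) * (p - i) * (q - j) * (i + j + l)"
        using d Yq jl by (intro no_carry_bound) (auto simp: digits_def)
      also have "\<dots> = x + (q - l) * (p - i) * (q - j) * b"
        unfolding xY jl b by (simp add: algebra_simps)
      also have "\<dots> \<le> borrow_sum (borrow_ap b) i j l"
        unfolding xb by (rule borrow_sum_ge_no_carry[OF d])
      finally show ?thesis
        unfolding card .
    next
      case 2
      then have "j + l = q + Y" "b = i + Y + q + 1"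
        by (auto simp: e_def Y_def)
      with carry_bound[OF d Y0] show ?thesis
        unfolding card by simp
    qed
  qed
qed

text \<open>As \<open>q = (m + q) - m\<close>, its only non-zero digit is \<open>i = 1\<close> and
  \<open>b = 1\<close>. The pattern without borrows is truncated to 0, and no borrow leaves
  \<open>l\<close>.\<close>

lemma card_sg_diff_q: "int (card {s \<in> sg. s - q \<notin> sg}) = p * q * q - q * q + q"
proof -
  have d: "digits 1 0 0"
    using p2 q2 by (simp add: digits_def)
  have "q = val (- 1) 1 0 0"
    by (simp add: val_def)
  then have "int (card {s \<in> sg. s - q \<notin> sg}) = borrow_sum (borrow_ap 1) 1 0 0"
    using card_sg_diff[OF d, of 1] by simp
  also have "\<dots> = q * ((q - 1) * (p - 2) + (p + q - 1))"
    using p2 q2 by (simp add: borrow_sum_def borrow_ap_def)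
  finally show ?thesis
    by (simp add: algebra_simps)
qed

section \<open>Cofiniteness and the four generators\<close>

lemma sg_cofinite:
  assumes "p * (m + q) + q * (m + p * q) + q * (m + p * q + 1) \<le> z"
  shows "z \<in> sg"
proof -
  obtain a i j l where d: "digits i j l" and z: "z = val a i j l"
    using val_surj by blast
  have m: "0 < m"
    using p2 q2 by (simp add: m_def)
  have "i * (m + q) \<le> p * (m + q)" "j * (m + p * q) \<le> q * (m + p * q)"
    "l * (m + p * q + 1) < q * (m + p * q + 1)"
    using d p2 q2 m
    by (auto simp: digits_def intro!: mult_right_mono mult_strict_right_mono add_pos_pos)
  with assms have "0 < a * m"
    unfolding z val_def by linarith
  with m have "0 \<le> a"
    by (simp add: zero_less_mult_iff)
  with d show ?thesis
    by (simp add: z val_mem_sg)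
qed

text \<open>Arbitrary coefficients are normalised by carrying from \<open>l\<close> to
  \<open>i\<close> to \<open>j\<close> to \<open>a\<close>; \<open>c3\<close>, \<open>c1\<close>,
  \<open>c2\<close> are the carries, and the leading coefficient never decreases.\<close>

lemma mem_sg_iff:
  "z \<in> sg \<longleftrightarrow> (\<exists>k0 k1 k2 k3. 0 \<le> k0 \<and> 0 \<le> k1 \<and> 0 \<le> k2 \<and> 0 \<le> k3 \<and> z = val k0 k1 k2 k3)"
proof
  assume "z \<in> sg"
  then show "\<exists>k0 k1 k2 k3. 0 \<le> k0 \<and> 0 \<le> k1 \<and> 0 \<le> k2 \<and> 0 \<le> k3 \<and> z = val k0 k1 k2 k3"
    unfolding sg_def digits_def by blast
next
  assume "\<exists>k0 k1 k2 k3. 0 \<le> k0 \<and> 0 \<le> k1 \<and> 0 \<le> k2 \<and> 0 \<le> k3 \<and> z = val k0 k1 k2 k3"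
  then obtain k0 k1 k2 k3 where k: "0 \<le> k0" "0 \<le> k1" "0 \<le> k2" "0 \<le> k3"
    and z: "z = val k0 k1 k2 k3"
    by blast
  define l c3 where "l = k3 mod q" and "c3 = k3 div q"
  define i c1 where "i = (k1 + c3) mod p" and "c1 = (k1 + c3) div p"
  define j c2 where "j = (k2 + c1) mod q" and "c2 = (k2 + c1) div q"
  have d: "digits i j l"
    using p2 q2 by (simp add: digits_def i_def j_def l_def)
  have c: "0 \<le> c3" "0 \<le> c1" "0 \<le> c2"
    using k p2 q2 by (simp_all add: c1_def c2_def c3_def pos_imp_zdiv_nonneg_iff)
  have k_eq: "k3 = l + q * c3" "k1 = i + p * c1 - c3" "k2 = j + q * c2 - c1"
    unfolding l_def c3_def i_def c1_def j_def c2_def by simp_all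
  have "z = val (k0 + q * c3 + (p - 1) * c1 + (q + 1) * c2) i j l"
    unfolding z k_eq by (simp add: val_def m_def algebra_simps)
  moreover have "0 \<le> k0 + q * c3 + (p - 1) * c1 + (q + 1) * c2"
    using k c p2 q2 by simp
  ultimately show "z \<in> sg"
    using d by (simp add: val_mem_sg)
qed

end

section \<open>Transfer to natural numbers\<close>

lemma mem_suzuki_iff:
  "s \<in> suzuki p n \<longleftrightarrow> (\<exists>k0 k1 k2 k3. s = k0 * p ^ (2 * n + 1) + k1 * (p ^ (2 * n + 1) + p ^ n)
    + k2 * (p ^ (2 * n + 1) + p ^ (n + 1)) + k3 * (p ^ (2 * n + 1) + p ^ (n + 1) + 1))"
proof -
  have "(\<Sum>i<length [x0, x1, x2, x3]. k i * [x0, x1, x2, x3] ! i) = k 0 * x0 + k 1 * x1 + k 2 * x2 + k 3 * x3"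
    for k :: "nat \<Rightarrow> nat" and x0 x1 x2 x3
    by (simp add: eval_nat_numeral)
  then have gen: "s \<in> generated [x0, x1, x2, x3] \<longleftrightarrow>
      (\<exists>k :: nat \<Rightarrow> nat. s = k 0 * x0 + k 1 * x1 + k 2 * x2 + k 3 * x3)" for x0 x1 x2 x3
    unfolding generated_def by (simp only: mem_Collect_eq simp_thms)
  have "(\<exists>k :: nat \<Rightarrow> nat. P (k 0) (k 1) (k 2) (k 3)) \<longleftrightarrow> (\<exists>k0 k1 k2 k3. P k0 k1 k2 k3)" for P
  proof
    assume "\<exists>k0 k1 k2 k3. P k0 k1 k2 k3"
    then obtain k0 k1 k2 k3 where "P k0 k1 k2 k3"
      by blast
    then show "\<exists>k :: nat \<Rightarrow> nat. P (k 0) (k 1) (k 2) (k 3)"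
      by (intro exI[of _ "\<lambda>t. [k0, k1, k2, k3] ! t"]) (simp add: eval_nat_numeral)
  qed blast
  then show ?thesis
    unfolding suzuki_def gen by simp
qed

lemma suzuki_one: "suzuki 1 n = UNIV"
proof -
  have "s \<in> suzuki 1 n" for s
    unfolding mem_suzuki_iff by (rule exI[of _ s], (rule exI[of _ 0])+) simp
  then show ?thesis
    by blast
qed

lemma (in suzuki_params) mem_suzuki_sg:
  assumes "p = int p'" "q = int p' ^ n"
  shows "s \<in> suzuki p' n \<longleftrightarrow> int s \<in> sg"
proof -
  have m: "m = int (p' ^ (2 * n + 1))"
    unfolding m_def unfolding assms by (simp add: mult_2 power_add)
  have val: "val (int k0) (int k1) (int k2) (int k3) = int (k0 * p' ^ (2 * n + 1) + k1 * (p' ^ (2 * n + 1) + p' ^ n)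
    + k2 * (p' ^ (2 * n + 1) + p' ^ (n + 1)) + k3 * (p' ^ (2 * n + 1) + p' ^ (n + 1) + 1))" for k0 k1 k2 k3
    unfolding val_def m by (simp add: assms algebra_simps)
  show ?thesis
  proof
    assume "s \<in> suzuki p' n"
    then obtain k0 k1 k2 k3 where "int s = val (int k0) (int k1) (int k2) (int k3)"
      unfolding mem_suzuki_iff val by blast
    then show "int s \<in> sg"
      unfolding mem_sg_iff by (meson of_nat_0_le_iff)
  next
    assume "int s \<in> sg"
    then obtain k0 k1 k2 k3 where "int s = val (int k0) (int k1) (int k2) (int k3)"
      unfolding mem_sg_iff by (metis nonneg_int_cases)
    then show "s \<in> suzuki p' n"
      unfolding mem_suzuki_iff val by (metis of_nat_eq_iff)
  qed
qed

lemma (in suzuki_params) card_apery_suzuki: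
  assumes "p = int p'" "q = int p' ^ n"
  shows "card (apery (suzuki p' n) x) = card {s \<in> sg. s - int x \<notin> sg}"
proof -
  note mem = mem_suzuki_sg[OF assms]
  have "int ` apery (suzuki p' n) x = {s \<in> sg. s - int x \<notin> sg}"
  proof (intro equalityI subsetI)
    fix s assume "s \<in> int ` apery (suzuki p' n) x"
    then obtain t where t: "s = int t" "int t \<in> sg" "x \<le> t \<longrightarrow> int (t - x) \<notin> sg"
      by (auto simp: apery_def mem)
    \<comment> \<open>A negative difference lies outside \<open>sg\<close>, in agreement with the
      guard in \<open>apery\<close>.\<close>
    have "int t - int x \<notin> sg"
    proof (cases "x \<le> t")
      case False
      then show ?thesis
        using sg_nonneg[of "int t - int x"] by auto
    qed (use t in \<open>simp add: of_nat_diff\<close>)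
    with t show "s \<in> {s \<in> sg. s - int x \<notin> sg}"
      by simp
  next
    fix s assume s: "s \<in> {s \<in> sg. s - int x \<notin> sg}"
    then obtain t where t: "s = int t"
      using sg_nonneg nonneg_int_cases by blast
    with s have "t \<in> apery (suzuki p' n) x"
      by (auto simp: apery_def mem of_nat_diff)
    with t show "s \<in> int ` apery (suzuki p' n) x"
      by blast
  qed
  moreover have "card (int ` apery (suzuki p' n) x) = card (apery (suzuki p' n) x)"
    by (rule card_image) simp
  ultimately show ?thesis
    by simp
qed

theorem theorem24:
  fixes p n :: nat
  assumes "p > 0" and "n > 0"
  shows "feng_rao_number2 (suzuki p n) = int p ^ (2 * n + 1) - int p ^ (2 * n) + int p ^ n"
proof (cases "p = 1")
  case True
  \<comment> \<open>For \<open>p = 1\<close> the semigroup is all of \<open>UNIV\<close>, and the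
    smallest Apery set has one element, at \<open>x = 1\<close>.\<close>
  have "apery UNIV x = {..<x}" for x
    by (auto simp: apery_def)
  then have "feng_rao_number2 UNIV = int 1"
    by (intro feng_rao_number2_eqI[of _ _ 1]) auto
  then show ?thesis
    using True suzuki_one[of n] by simp
next
  case False
  \<comment> \<open>Positivity of \<open>n\<close> provides the locale assumption
    \<open>p \<le> q\<close>.\<close>
  have "p ^ 1 \<le> p ^ n"
    using assms by (intro power_increasing) auto
  then interpret suzuki_params "int p" "int p ^ n"
    using assms False by unfold_locales (auto simp flip: of_nat_power)
  define N where "N = card {s \<in> sg. s - int p ^ n \<notin> sg}"
  note card = card_apery_suzuki[OF refl refl]
  have N: "int N = int p * int p ^ n * int p ^ n - int p ^ n * int p ^ n + int p ^ n"
    unfolding N_def by (rule card_sg_diff_q)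
  have "feng_rao_number2 (suzuki p n) = int N"
  proof (rule feng_rao_number2_eqI)
    obtain M where M: "\<And>z. M \<le> z \<Longrightarrow> z \<in> sg"
      using sg_cofinite by blast
    have "- suzuki p n \<subseteq> {..<nat M}"
    proof
      fix s assume "s \<in> - suzuki p n"
      then have "\<not> M \<le> int s"
        using M mem_suzuki_sg[OF refl refl] by blast
      then show "s \<in> {..<nat M}"
        by simp
    qed
    then show "finite (- suzuki p n)"
      using finite_subset by blast
  next
    fix x :: nat assume "0 < x"
    then show "N \<le> card (apery (suzuki p n) x)"
      using card_sg_diff_ge[of "int x"] N unfolding card by linarith
  next
    show "0 < p ^ n" "card (apery (suzuki p n) (p ^ n)) = N"
      using assms unfolding card N_def by simp_all
  qed
  also have "\<dots> = int p ^ (2 * n + 1) - int p ^ (2 * n) + int p ^ n"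
    unfolding N by (simp add: mult_2 power_add)
  finally show ?thesis .
qed

end
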